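(* Let $\mathcal D=[\mathring u_{\min},\mathring u_{\max}]$ and consider the blended cell-average scheme $$\bar u_{j+1/2}^{n+1}=\bar u_{j+1/2}^n-\lambda(\mathcal F_{j+1}-\mathcal F_j),\qquad \mathcal F_j=\mathcal F_j^{LO}+\eta_j\,\Delta\mathcal F_j,$$ with all quantities as defined in the context, and under the CFL condition $\Delta t^n\le \Delta x/(\alpha_j+\alpha_{j+1})$ for all $j$. If we set $$\eta_j=\min\Big(1,\ \frac{\alpha_j}{|\Delta\mathcal F_j|}\min\big(\mathring u_{\max}-u_j^*,\ u_j^*-\mathring u_{\min}\big)\Big)\qquad\text{for all } j$$ (with $\eta_j=1$ when $\Delta\mathcal F_j=0$), then the scheme has the following property for every $n$: if $\bar u_{j+1/2}^n\in\mathcal D$ for all $j$, then $\bar u_{j+1/2}^{n+1}\in\mathcal D$ for all $j$.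
   Context: The scheme approximates the scalar conservation law $u_t+f(u)_x=0$, with flux function $f$, on a uniform mesh with nodes $x_j$, cells $[x_j,x_{j+1}]$ and cell size $\Delta x>0$. The time step is $\Delta t^n=t^{n+1}-t^n>0$ and $\lambda=\Delta t^n/\Delta x$. At time $t^n$ the data are cell averages $\bar u_{j+1/2}^n\in\mathbb R$ (on $[x_j,x_{j+1}]$) and point values $u_j^n\in\mathbb R$ (at $x_j$). The interval $\mathcal D$ is the invariant domain, an interval containing the values of the initial datum. Definitions: $$\alpha_j=\max\big(|f'(\bar u_{j-1/2}^n)|,\,|f'(\bar u_{j+1/2}^n)|\big)\quad(\text{taken to be positive, since one divides by it}),$$ $$\mathcal F_j^{LO}=\frac{f(\bar u_{j-1/2}^n)+f(\bar u_{j+1/2}^n)}{2}-\frac{\alpha_j}{2}\big(\bar u_{j+1/2}^n-\bar u_{j-1/2}^n\big),\qquad \Delta\mathcal F_j=f(u_j^n)-\mathcal F_j^{LO},$$ $$u_j^*=\frac{\bar u_{j-1/2}^n+\bar u_{j+1/2}^n}{2}-\frac{f(\bar u_{j+1/2}^n)-f(\bar u_{j-1/2}^n)}{2\alpha_j}.$$ Equivalently, the scheme reads $$\bar u_{j+1/2}^{n+1}=(1-\lambda\alpha_j-\lambda\alpha_{j+1})\bar u_{j+1/2}^n+\lambda\alpha_j\Big(u_j^*+\eta_j\frac{\Delta\mathcal F_j}{\alpha_j}\Big)+\lambda\alpha_{j+1}\Big(u_{j+1}^*-\eta_{j+1}\frac{\Delta\mathcal F_{j+1}}{\alpha_{j+1}}\Big),$$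 which is a convex combination under the stated CFL condition.
   Formalization: Added hypothesis: α_j ≥ |f'(x)| for all x between the two adjacent cell averages (automatic for convex or concave f, f differentiable on D). Without it the claim fails: f=x+27x²−18x³, D=[0,1], averages and point values 0 for j<0, 1 for j≥0, λ=1/2 give a new average −4. *)

theory Defs
  imports "HOL-Analysis.Analysis"
begin

text \<open>
  The mesh is indexed by all integers. In the definitions below \<open>v j\<close> is the cell
  average on the cell to the right of the node \<open>x\<^sub>j\<close>, i.e. the half-integer index
  \<open>j + 1/2\<close> is written \<open>j\<close> and \<open>j - 1/2\<close> is written \<open>j - 1\<close>;
  \<open>w j\<close> is the point value at the node \<open>x\<^sub>j\<close>.
\<close>

definition alpha :: "(real \<Rightarrow> real) \<Rightarrow> (int \<Rightarrow> real) \<Rightarrow> int \<Rightarrow> real" where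
  "alpha f v j = max \<bar>deriv f (v (j - 1))\<bar> \<bar>deriv f (v j)\<bar>"

definition flux_LO :: "(real \<Rightarrow> real) \<Rightarrow> (int \<Rightarrow> real) \<Rightarrow> int \<Rightarrow> real" where
  "flux_LO f v j = (f (v (j - 1)) + f (v j)) / 2 - alpha f v j / 2 * (v j - v (j - 1))"

definition delta_flux :: "(real \<Rightarrow> real) \<Rightarrow> (int \<Rightarrow> real) \<Rightarrow> (int \<Rightarrow> real) \<Rightarrow> int \<Rightarrow> real" where
  "delta_flux f v w j = f (w j) - flux_LO f v j"

definition u_star :: "(real \<Rightarrow> real) \<Rightarrow> (int \<Rightarrow> real) \<Rightarrow> int \<Rightarrow> real" where
  "u_star f v j = (v (j - 1) + v j) / 2 - (f (v j) - f (v (j - 1))) / (2 * alpha f v j)"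

definition blended_flux ::
    "(real \<Rightarrow> real) \<Rightarrow> (int \<Rightarrow> real) \<Rightarrow> (int \<Rightarrow> real) \<Rightarrow> (int \<Rightarrow> real) \<Rightarrow> int \<Rightarrow> real" where
  "blended_flux f v w \<eta> j = flux_LO f v j + \<eta> j * delta_flux f v w j"

definition limiter ::
    "(real \<Rightarrow> real) \<Rightarrow> real \<Rightarrow> real \<Rightarrow> (int \<Rightarrow> real) \<Rightarrow> (int \<Rightarrow> real) \<Rightarrow> int \<Rightarrow> real" where
  "limiter f umin umax v w j =
     (if delta_flux f v w j = 0 then 1
      else min 1 (alpha f v j / \<bar>delta_flux f v w j\<bar>
                    * min (umax - u_star f v j) (u_star f v j - umin)))"

text \<open>
  The coefficient \<open>alpha\<close> samples \<open>\<bar>f'\<bar>\<close> only at the two adjacent cell averages.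
  For a flux with an inflection point between them it can be smaller than the local wave
  speed, and then \<open>u_star\<close> can leave the invariant interval. The conclusion of the following
  lemma, that \<open>alpha\<close> is the largest wave speed between the two averages, excludes this;
  it holds for every convex and every concave flux.
\<close>

lemma alpha_bounds_wave_speed:
  assumes "mono_on {umin..umax} (deriv f) \<or> antimono_on {umin..umax} (deriv f)"
    and v: "\<forall>j. v j \<in> {umin..umax}"
    and x: "x \<in> closed_segment (v (j - 1)) (v j)"
  shows "\<bar>deriv f x\<bar> \<le> alpha f v j"
proof -
  have vb: "umin \<le> v (j - 1)" "v (j - 1) \<le> umax" "umin \<le> v j" "v j \<le> umax"
    using v by auto
  have xs: "(v (j - 1) \<le> x \<and> x \<le> v j) \<or> (v j \<le> x \<and> x \<le> v (j - 1))"
    using x by (auto simp: closed_segment_eq_real_ivl split: if_splits)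
  have mem: "x \<in> {umin..umax}" "v (j - 1) \<in> {umin..umax}" "v j \<in> {umin..umax}"
    using vb xs by auto
  have "(deriv f (v (j - 1)) \<le> deriv f x \<and> deriv f x \<le> deriv f (v j))
      \<or> (deriv f (v j) \<le> deriv f x \<and> deriv f x \<le> deriv f (v (j - 1)))"
    using assms(1) xs mem by (meson monotone_onD)
  then show ?thesis
    unfolding alpha_def by linarith
qed

end

theory Submission
  imports Defs
begin

text \<open>
  Around the node \<open>j\<close> the low-order flux is an HLL-type flux whose intermediate state is
  \<open>u\<^sub>j\<^sup>* = u_star f v j\<close>: seen from the left cell it is \<open>f (v (j - 1)) + \<alpha>\<^sub>j (v (j - 1) - u\<^sub>j\<^sup>*)\<close>,
  seen from the right cell it is \<open>f (v j) + \<alpha>\<^sub>j (u\<^sub>j\<^sup>* - v j)\<close>. In the difference of the two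
  fluxes of one cell the values \<open>f (v j)\<close> cancel, and the updated average becomes a combination,
  with \<open>\<lambda> = dt / dx\<close> and weights \<open>1 - \<lambda>\<alpha>\<^sub>j - \<lambda>\<alpha>\<^sub>j\<^sub>+\<^sub>1\<close>, \<open>\<lambda>\<alpha>\<^sub>j\<close> and \<open>\<lambda>\<alpha>\<^sub>j\<^sub>+\<^sub>1\<close>, of the old average and of two
  intermediate states, each shifted by the blended correction divided by \<open>\<alpha>\<close>
  (\<open>blended_update_convex_form\<close>). The CFL condition makes the weights nonnegative.

  It remains to see that all three states lie in the invariant interval. The intermediate state
  does because \<open>\<alpha>\<^sub>j\<close> is a Lipschitz constant of \<open>f\<close> between the two averages
  (\<open>flux_jump_le_alpha\<close>), so that \<open>u\<^sub>j\<^sup>*\<close> lies between them (\<open>u_star_mem\<close>). The limiter is then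
  precisely the choice that keeps the shift within the distance from \<open>u\<^sub>j\<^sup>*\<close> to the nearer
  end of the interval (\<open>limited_correction_le\<close>); since this bounds the absolute value of
  the shift, the same coefficient serves the two cells adjacent to the node, where the shift
  enters with opposite signs.
\<close>

lemma flux_jump_le_alpha:
  assumes diff: "\<forall>x\<in>{umin..umax}. f differentiable (at x)"
    and speed: "\<forall>x\<in>closed_segment (v (j - 1)) (v j). \<bar>deriv f x\<bar> \<le> alpha f v j"
    and v: "v (j - 1) \<in> {umin..umax}" "v j \<in> {umin..umax}"
  shows "\<bar>f (v j) - f (v (j - 1))\<bar> \<le> alpha f v j * \<bar>v j - v (j - 1)\<bar>"
proof -
  let ?S = "closed_segment (v (j - 1)) (v j)"
  have sub: "?S \<subseteq> {umin..umax}"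
    using v by (intro closed_segment_subset) auto
  have "norm (f (v j) - f (v (j - 1))) \<le> alpha f v j * norm (v j - v (j - 1))"
  proof (rule field_differentiable_bound)
    show "(f has_field_derivative deriv f x) (at x within ?S)" if "x \<in> ?S" for x
      using that sub diff
      by (meson DERIV_deriv_iff_real_differentiable has_field_derivative_at_within subsetD)
    show "norm (deriv f x) \<le> alpha f v j" if "x \<in> ?S" for x
      using that speed by simp
  qed auto
  then show ?thesis by simp
qed

text \<open>
  The state \<open>u\<^sub>j\<^sup>*\<close> is the midpoint of the two averages minus the flux jump divided by
  \<open>2\<alpha>\<^sub>j\<close>. A jump of at most \<open>\<alpha>\<^sub>j\<close> times the distance of the averages moves the
  midpoint by at most half of that distance, that is, not beyond either average.
\<close>

lemma u_star_mem:
  assumes pos: "alpha f v j > 0"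
    and jump: "\<bar>f (v j) - f (v (j - 1))\<bar> \<le> alpha f v j * \<bar>v j - v (j - 1)\<bar>"
    and v: "v (j - 1) \<in> {umin..umax}" "v j \<in> {umin..umax}"
  shows "u_star f v j \<in> {umin..umax}"
proof -
  define r where "r = (f (v j) - f (v (j - 1))) / (2 * alpha f v j)"
  have "\<bar>r\<bar> = \<bar>f (v j) - f (v (j - 1))\<bar> / (2 * alpha f v j)"
    using pos by (simp add: r_def abs_divide abs_mult)
  also have "\<dots> \<le> \<bar>v j - v (j - 1)\<bar> / 2"
    using pos jump by (simp add: field_simps)
  finally have r: "r \<le> \<bar>v j - v (j - 1)\<bar> / 2" "- r \<le> \<bar>v j - v (j - 1)\<bar> / 2"
    by linarith+
  have star: "u_star f v j = (v (j - 1) + v j) / 2 - r"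
    by (simp add: u_star_def r_def)
  show ?thesis
    using r v unfolding star
    by (cases "v (j - 1) \<le> v j") (simp_all add: field_simps)
qed

text \<open>
  If \<open>d\<close> is the distance from \<open>u\<^sub>j\<^sup>*\<close> to the nearer end of the interval, the second argument
  of the outer minimum in the limiter is the value of \<open>\<eta>\<close> at which the shift
  \<open>\<eta> \<bar>\<Delta>F\<^sub>j\<bar> / \<alpha>\<^sub>j\<close> equals \<open>d\<close>. Membership of \<open>u\<^sub>j\<^sup>*\<close> in the interval
  makes \<open>d\<close>, hence the limiter, nonnegative, so that a bound on \<open>\<eta>\<close> from above bounds the
  absolute value of the shift.
\<close>

lemma limited_correction_le:
  assumes pos: "alpha f v j > 0"
    and star: "u_star f v j \<in> {umin..umax}"
  shows "\<bar>limiter f umin umax v w j * delta_flux f v w j / alpha f v j\<bar>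
    \<le> min (umax - u_star f v j) (u_star f v j - umin)"
proof -
  define d where "d = min (umax - u_star f v j) (u_star f v j - umin)"
  define D where "D = delta_flux f v w j"
  define l where "l = limiter f umin umax v w j"
  have d: "0 \<le> d"
    using star by (simp add: d_def)
  have "\<bar>l * D / alpha f v j\<bar> \<le> d"
  proof (cases "D = 0")
    case True
    then show ?thesis using d by simp
  next
    case False
    then have l: "l = min 1 (alpha f v j / \<bar>D\<bar> * d)"
      by (simp add: l_def D_def d_def limiter_def)
    have "0 \<le> l"
      using l pos d by simp
    then have "\<bar>l * D / alpha f v j\<bar> = l * (\<bar>D\<bar> / alpha f v j)"
      using pos by (simp add: abs_mult)
    also have "\<dots> \<le> alpha f v j / \<bar>D\<bar> * d * (\<bar>D\<bar> / alpha f v j)"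
      using l pos by (intro mult_right_mono) auto
    also have "\<dots> = d"
      using pos False by simp
    finally show ?thesis .
  qed
  then show ?thesis
    by (simp add: l_def D_def d_def)
qed

lemma flux_LO_from_left:
  assumes "alpha f v j \<noteq> 0"
  shows "flux_LO f v j = f (v (j - 1)) + alpha f v j * (v (j - 1) - u_star f v j)"
  using assms by (simp add: flux_LO_def u_star_def field_simps)

lemma flux_LO_from_right:
  assumes "alpha f v j \<noteq> 0"
  shows "flux_LO f v j = f (v j) + alpha f v j * (u_star f v j - v j)"
  using assms by (simp add: flux_LO_def u_star_def field_simps)

text \<open>
  The flux at the right node of the cell is expanded from its left side and the flux at the
  left node from its right side: both expansions then refer to \<open>f (v j)\<close>, which cancels.
\<close>

lemma blended_update_convex_form:
  assumes "alpha f v j \<noteq> 0" "alpha f v (j + 1) \<noteq> 0"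
  shows "v j - r * (blended_flux f v w \<eta> (j + 1) - blended_flux f v w \<eta> j)
    = (1 - r * alpha f v j - r * alpha f v (j + 1)) * v j
      + r * alpha f v j * (u_star f v j + \<eta> j * delta_flux f v w j / alpha f v j)
      + r * alpha f v (j + 1) *
          (u_star f v (j + 1) - \<eta> (j + 1) * delta_flux f v w (j + 1) / alpha f v (j + 1))"
proof -
  have cancel: "r * alpha f v i * (x / alpha f v i) = r * x" if "alpha f v i \<noteq> 0" for i x
    using that by simp
  show ?thesis
    unfolding blended_flux_def flux_LO_from_right[OF assms(1)] flux_LO_from_left[OF assms(2)]
      distrib_left[of "r * alpha f v j"] right_diff_distrib[of "r * alpha f v (j + 1)"]
      cancel[OF assms(1)] cancel[OF assms(2)]
    by (simp add: algebra_simps)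
qed

lemma three_point_combination_mem:
  fixes a b x y z lo hi :: real
  assumes "0 \<le> a" "0 \<le> b" "a + b \<le> 1"
    and "x \<in> {lo..hi}" "y \<in> {lo..hi}" "z \<in> {lo..hi}"
  shows "(1 - a - b) * x + a * y + b * z \<in> {lo..hi}"
proof -
  have "(1 - a - b) * lo + a * lo + b * lo \<le> (1 - a - b) * x + a * y + b * z"
    using assms by (intro add_mono mult_left_mono) auto
  moreover have "(1 - a - b) * x + a * y + b * z \<le> (1 - a - b) * hi + a * hi + b * hi"
    using assms by (intro add_mono mult_left_mono) auto
  ultimately show ?thesis
    by (simp add: algebra_simps)
qed

theorem proposition3p1:
  fixes f :: "real \<Rightarrow> real"
    and umin umax dx :: real
    and dt :: "nat \<Rightarrow> real"
    and ubar u \<eta> :: "nat \<Rightarrow> int \<Rightarrow> real"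
    and n :: nat
  assumes differentiable: "\<forall>x\<in>{umin..umax}. f differentiable (at x)"
    and mesh: "dx > 0"
    and time_step: "dt n > 0"
    and alpha_pos: "\<forall>j. alpha f (ubar n) j > 0"
    and wave_speed: "\<forall>j. \<forall>x\<in>closed_segment (ubar n (j - 1)) (ubar n j).
                       \<bar>deriv f x\<bar> \<le> alpha f (ubar n) j"
    and CFL: "\<forall>j. dt n \<le> dx / (alpha f (ubar n) j + alpha f (ubar n) (j + 1))"
    and eta: "\<forall>j. \<eta> n j = limiter f umin umax (ubar n) (u n) j"
    and scheme: "\<forall>j. ubar (Suc n) j = ubar n j
                   - dt n / dx * (blended_flux f (ubar n) (u n) (\<eta> n) (j + 1)
                                  - blended_flux f (ubar n) (u n) (\<eta> n) j)"
  shows "(\<forall>j. ubar n j \<in> {umin..umax}) \<longrightarrow> (\<forall>j. ubar (Suc n) j \<in> {umin..umax})"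
proof (intro impI allI)
  fix j
  assume inv: "\<forall>j. ubar n j \<in> {umin..umax}"
  let ?a = "alpha f (ubar n)" and ?s = "u_star f (ubar n)" and ?l = "dt n / dx"
  let ?c = "\<lambda>i. \<eta> n i * delta_flux f (ubar n) (u n) i / ?a i"
  have star: "?s i \<in> {umin..umax}" for i
    using alpha_pos inv flux_jump_le_alpha[OF differentiable] wave_speed
    by (intro u_star_mem) auto
  have shift: "\<bar>?c i\<bar> \<le> min (umax - ?s i) (?s i - umin)" for i
    unfolding eta[rule_format] using alpha_pos star by (intro limited_correction_le) auto
  have shifted: "?s i + ?c i \<in> {umin..umax}" "?s i - ?c i \<in> {umin..umax}" for i
    using shift[of i] unfolding atLeastAtMost_iff by (intro conjI; linarith)+
  have pos: "0 < ?a i" for i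
    using alpha_pos by blast
  have "dt n * (?a j + ?a (j + 1)) \<le> dx"
    using CFL[rule_format, of j] add_pos_pos[OF pos[of j] pos[of "j + 1"]]
    by (simp add: pos_le_divide_eq)
  then have weights: "?l * ?a j + ?l * ?a (j + 1) \<le> 1"
    using mesh by (simp add: field_simps)
  have "0 \<le> ?l * ?a i" for i
    using mesh time_step pos[of i] by simp
  then have "(1 - ?l * ?a j - ?l * ?a (j + 1)) * ubar n j
      + ?l * ?a j * (?s j + ?c j) + ?l * ?a (j + 1) * (?s (j + 1) - ?c (j + 1)) \<in> {umin..umax}"
    using weights inv shifted by (intro three_point_combination_mem) blast+
  moreover have "?a j \<noteq> 0" "?a (j + 1) \<noteq> 0"
    using pos by (simp_all add: less_imp_neq[symmetric])
  ultimately show "ubar (Suc n) j \<in> {umin..umax}"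
    unfolding scheme[rule_format] by (subst blended_update_convex_form)
qed

end
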